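(* There is an almost disjoint family $\mathcal A$ of size $\mathfrak c$ on a countable set such that $\mathsf S_{\mathrm{fin}}(\mathcal I(\mathcal A)^+,\mathcal I(\mathcal A)^+)$ holds and Player I has a winning strategy in $\mathsf G_{\mathrm{fin}}(\mathcal I(\mathcal A)^+,\mathcal I(\mathcal A)^+)$. Consequently, there is a complete bounded distributive lattice of size $\mathfrak c$, with greatest element $1$, that satisfies $\mathsf S_{\mathrm{fin}}(\mathsf V_1,\mathsf V_1)$ and on which Player I has a winning strategy in $\mathsf G_{\mathrm{fin}}(\mathsf V_1,\mathsf V_1)$.
   Context: $\mathfrak c=2^{\aleph_0}$. Let $D$ be a countably infinite set. A family $\mathcal A\subseteq[D]^\omega$ of infinite subsets of $D$ is almost disjoint if distinct members have finite intersection. For an infinite almost disjoint family $\mathcal A$ on $D$, put $$\mathcal I(\mathcal A)=\{S\subseteq D:S\subseteq^*\textstyle\bigcup\mathcal F\text{ for some finite }\mathcal F\subseteq\mathcal A\},$$ where $S\subseteq^*T$ means that $S\setminus T$ is finite; let $\mathcal I(\mathcal A)^+=\mathcal P(D)\setminus\mathcal I(\mathcal A)$. For a poset with greatest element $1$, $\mathsf V_1$ denotes the family of all nonempty subsets whose supremum is $1$. For a nonempty family $\mathcal B$ of nonempty subsets of a set $E$: $\mathsf S_{\mathrm{fin}}(\mathcal B,\mathcal B)$ asserts that for every sequence $(A_n)_{n\in\omega}$ in $\mathcal B$ there are finite sets $F_n\subseteq A_n$ with $\bigcup_{n\in\omega}F_n\in\mathcal B$. In the game $\mathsf G_{\mathrm{fin}}(\mathcal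 B,\mathcal B)$, in each inning $n\in\omega$ Player I chooses $A_n\in\mathcal B$ and then Player II chooses a finite subset $F_n\subseteq A_n$ (possibly empty); Player II wins if $\bigcup_{n\in\omega}F_n\in\mathcal B$, otherwise Player I wins. A strategy is a function telling a player how to play based on the previous moves of the opponent. *)

theory Defs
  imports "HOL-Algebra.Complete_Lattice" "HOL-Library.Equipollence"
begin

definition almost_disjoint_family :: "'a set \<Rightarrow> 'a set set \<Rightarrow> bool" where
  "almost_disjoint_family D \<A> \<longleftrightarrow>
     (\<forall>X\<in>\<A>. X \<subseteq> D \<and> infinite X) \<and> pairwise (\<lambda>X Y. finite (X \<inter> Y)) \<A>"

definition ad_ideal :: "'a set \<Rightarrow> 'a set set \<Rightarrow> 'a set set" where
  "ad_ideal D \<A> = {S. S \<subseteq> D \<and> (\<exists>\<F>. finite \<F> \<and> \<F> \<subseteq> \<A> \<and> finite (S - \<Union>\<F>))}"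

definition ad_positive :: "'a set \<Rightarrow> 'a set set \<Rightarrow> 'a set set" where
  "ad_positive D \<A> = Pow D - ad_ideal D \<A>"

locale distributive_lattice = lattice +
  assumes meet_join_distrib:
    "\<lbrakk>x \<in> carrier L; y \<in> carrier L; z \<in> carrier L\<rbrakk>
      \<Longrightarrow> x \<sqinter> (y \<squnion> z) = (x \<sqinter> y) \<squnion> (x \<sqinter> z)"

definition sup_top_families :: "('a, 'b) gorder_scheme \<Rightarrow> 'a set set" where
  "sup_top_families L =
     {B. B \<subseteq> carrier L \<and> B \<noteq> {} \<and> is_lub L (\<top>\<^bsub>L\<^esub>) B}"

definition S_fin :: "'a set set \<Rightarrow> 'a set set \<Rightarrow> bool" where
  "S_fin \<B> \<C> \<longleftrightarrow>
     (\<forall>A :: nat \<Rightarrow> 'a set. (\<forall>n. A n \<in> \<B>) \<longrightarrow>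
        (\<exists>F :: nat \<Rightarrow> 'a set. (\<forall>n. finite (F n) \<and> F n \<subseteq> A n) \<and> (\<Union>n. F n) \<in> \<C>))"

text \<open>
  A strategy for Player I maps the finite list of the previous moves of Player II to the next
  move of Player I. Against it, a sequence \<open>F\<close> of moves of Player II is legal if \<open>F n\<close> is a finite
  subset of the answer of the strategy to \<open>F 0, \<dots>, F (n - 1)\<close>, for every \<open>n\<close>. A winning strategy
  must itself make only legal moves against every such sequence; its values at unreachable
  positions are irrelevant. Testing legality only on infinite runs loses nothing, since every
  legal finite position extends to an infinite legal run by empty moves of Player II.
\<close>

type_synonym 'a strategy_I = "'a set list \<Rightarrow> 'a set"

definition I_move :: "'a strategy_I \<Rightarrow> (nat \<Rightarrow> 'a set) \<Rightarrow> nat \<Rightarrow> 'a set" where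
  "I_move \<sigma> F n = \<sigma> (map F [0..<n])"

definition G_fin_winning_strategy_I :: "'a set set \<Rightarrow> 'a set set \<Rightarrow> 'a strategy_I \<Rightarrow> bool" where
  "G_fin_winning_strategy_I \<B> \<C> \<sigma> \<longleftrightarrow>
     (\<forall>F :: nat \<Rightarrow> 'a set. (\<forall>n. finite (F n) \<and> F n \<subseteq> I_move \<sigma> F n) \<longrightarrow>
        (\<forall>n. I_move \<sigma> F n \<in> \<B>) \<and> (\<Union>n. F n) \<notin> \<C>)"

definition I_wins_G_fin :: "'a set set \<Rightarrow> 'a set set \<Rightarrow> bool" where
  "I_wins_G_fin \<B> \<C> \<longleftrightarrow> (\<exists>\<sigma>. G_fin_winning_strategy_I \<B> \<C> \<sigma>)"

end

theory Submission
  imports Defs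
begin

text \<open>
  For every almost disjoint family \<open>\<A>\<close> the selection principle holds for the positive sets, by an
  argument of Mathias. Given positive sets \<open>A n\<close>, consider the members of \<open>\<A>\<close> that meet the range
  of some choice sequence \<open>x n \<in> A n\<close> in an infinite set. If there are infinitely many of them, then
  countably many of the corresponding choice sequences can be merged diagonally into finite sets
  \<open>F n \<subseteq> A n\<close> whose union meets infinitely many members of \<open>\<A>\<close> in an infinite set, and such a union
  is positive. If there are only finitely many, then removing their union leaves the \<open>A n\<close> infinite,
  and the range of an injective choice sequence through the remainders is positive, as otherwise it
  would produce one more such member of \<open>\<A>\<close> (\<open>S_fin_ad_positive\<close>).

  It remains to find \<open>\<A>\<close> for which Player I wins. On the tree of finite sequences of natural numbers
  let Player I play the set of all immediate successors of a node. A finite reply lies below some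
  bound, and Player I extends the node by that bound. In the end the bounds form a branch \<open>f\<close>, and
  Player II has collected only nodes of the region of all \<open>f\<restriction>k \<frown> i\<close> with \<open>i \<le> f k\<close>. The regions of
  distinct branches are almost disjoint, because two branches that have separated do not meet again,
  and each region contains only finitely many successors of any one node. So for the family of all
  these regions, which has the size of the continuum, Player I plays positive sets and Player II ends
  up inside a single member of the family (\<open>I_wins_branch_regions\<close>).

  For the lattice, take the ideal together with the whole set as a new greatest element, ordered by
  inclusion. The supremum of a family is its union if this is in the ideal, and the greatest element
  otherwise. Hence a family has supremum \<open>1\<close> exactly if its union is positive
  (\<open>ideal_lattice.sup_top_families_iff\<close>), and both the selection principle and the winning strategy
  carry over, the latter by playing singletons.
\<close>

section \<open>The ideal of an almost disjoint family\<close>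

lemma ad_ideal_subset: "S \<in> ad_ideal D \<A> \<Longrightarrow> S \<subseteq> D"
  by (simp add: ad_ideal_def)

lemma ad_ideal_mono:
  assumes "T \<in> ad_ideal D \<A>" "S \<subseteq> T"
  shows "S \<in> ad_ideal D \<A>"
proof -
  obtain \<F> where "finite \<F>" "\<F> \<subseteq> \<A>" "finite (T - \<Union>\<F>)"
    using assms(1) by (auto simp: ad_ideal_def)
  moreover have "S - \<Union>\<F> \<subseteq> T - \<Union>\<F>" using assms(2) by blast
  ultimately have "finite (S - \<Union>\<F>)" by (blast intro: finite_subset)
  then show ?thesis
    using assms \<open>finite \<F>\<close> \<open>\<F> \<subseteq> \<A>\<close> ad_ideal_subset[OF assms(1)]
    unfolding ad_ideal_def by blast
qed

lemma ad_ideal_finite: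
  assumes "finite S" "S \<subseteq> D"
  shows "S \<in> ad_ideal D \<A>"
  unfolding ad_ideal_def using assms by (auto intro!: exI[of _ "{}"])

lemma ad_ideal_Un:
  assumes "S \<in> ad_ideal D \<A>" "T \<in> ad_ideal D \<A>"
  shows "S \<union> T \<in> ad_ideal D \<A>"
proof -
  obtain \<F> \<G> where F: "finite \<F>" "\<F> \<subseteq> \<A>" "finite (S - \<Union>\<F>)"
    and G: "finite \<G>" "\<G> \<subseteq> \<A>" "finite (T - \<Union>\<G>)"
    using assms by (auto simp: ad_ideal_def)
  have "(S \<union> T) - \<Union>(\<F> \<union> \<G>) \<subseteq> (S - \<Union>\<F>) \<union> (T - \<Union>\<G>)" by blast
  then have "finite ((S \<union> T) - \<Union>(\<F> \<union> \<G>))"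
    using F(3) G(3) by (blast intro: finite_subset)
  moreover have "finite (\<F> \<union> \<G>)" "\<F> \<union> \<G> \<subseteq> \<A>" "S \<union> T \<subseteq> D"
    using F G assms[THEN ad_ideal_subset] by auto
  ultimately show ?thesis unfolding ad_ideal_def by blast
qed

lemma ad_ideal_member:
  assumes "X \<in> \<A>" "X \<subseteq> D"
  shows "X \<in> ad_ideal D \<A>"
  unfolding ad_ideal_def using assms by (auto intro!: exI[of _ "{X}"])

lemma infinite_ad_ideal_meets_member:
  assumes "S \<in> ad_ideal D \<A>" "infinite S"
  obtains X where "X \<in> \<A>" "infinite (X \<inter> S)"
proof -
  obtain \<F> where F: "finite \<F>" "\<F> \<subseteq> \<A>" "finite (S - \<Union>\<F>)"
    using assms(1) by (auto simp: ad_ideal_def)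
  have "S \<subseteq> (S - \<Union>\<F>) \<union> (\<Union>X\<in>\<F>. X \<inter> S)" by blast
  then have "infinite (\<Union>X\<in>\<F>. X \<inter> S)"
    using assms(2) F(3) finite_subset finite_UnI by meson
  then obtain X where "X \<in> \<F>" "infinite (X \<inter> S)"
    using F(1) by (meson finite_UN_I)
  then show ?thesis using that F(2) by blast
qed

lemma ad_ideal_meets_finitely_many:
  assumes ad: "almost_disjoint_family D \<A>" and S: "S \<in> ad_ideal D \<A>"
  shows "finite {X \<in> \<A>. infinite (X \<inter> S)}"
proof -
  obtain \<F> where F: "finite \<F>" "\<F> \<subseteq> \<A>" "finite (S - \<Union>\<F>)"
    using S by (auto simp: ad_ideal_def)
  have "{X \<in> \<A>. infinite (X \<inter> S)} \<subseteq> \<F>"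
  proof (intro subsetI, rule ccontr)
    fix X assume X: "X \<in> {X \<in> \<A>. infinite (X \<inter> S)}" and "X \<notin> \<F>"
    have "finite (X \<inter> Y)" if "Y \<in> \<F>" for Y
    proof -
      have "X \<in> \<A>" "Y \<in> \<A>" "X \<noteq> Y" using X \<open>X \<notin> \<F>\<close> that F(2) by auto
      moreover have "pairwise (\<lambda>X Y. finite (X \<inter> Y)) \<A>"
        using ad by (simp add: almost_disjoint_family_def)
      ultimately show ?thesis by (meson pairwiseD)
    qed
    then have "finite (\<Union>Y\<in>\<F>. X \<inter> Y)" using F(1) by (rule finite_UN_I[rotated])
    then have "finite ((S - \<Union>\<F>) \<union> (\<Union>Y\<in>\<F>. X \<inter> Y))" using F(3) by (rule finite_UnI[rotated])
    moreover have "X \<inter> S \<subseteq> (S - \<Union>\<F>) \<union> (\<Union>Y\<in>\<F>. X \<inter> Y)" by blast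
    ultimately have "finite (X \<inter> S)" by (rule finite_subset[rotated])
    then show False using X by simp
  qed
  then show ?thesis using F(1) by (rule finite_subset)
qed

section \<open>The selection principle for positive sets\<close>

lemma injective_choice_sequence:
  fixes B :: "nat \<Rightarrow> 'a set"
  assumes "\<And>n. infinite (B n)"
  obtains x where "inj x" "\<And>n. x n \<in> B n"
proof -
  have "\<exists>x. \<forall>n. x n \<in> B n - x ` {..<n}"
  proof (rule dependent_wellorder_choice)
    fix r and f g :: "nat \<Rightarrow> 'a" and n :: nat
    assume "\<And>m. m < n \<Longrightarrow> f m = g m"
    then have "f ` {..<n} = g ` {..<n}" by (intro image_cong) auto
    then show "r \<in> B n - f ` {..<n} \<longleftrightarrow> r \<in> B n - g ` {..<n}" by simp
  next
    fix n :: nat and f :: "nat \<Rightarrow> 'a"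
    have "infinite (B n - f ` {..<n})" using assms by simp
    then show "\<exists>r. r \<in> B n - f ` {..<n}" by (metis ex_in_conv finite.emptyI)
  qed
  then obtain x where x: "\<And>n. x n \<in> B n - x ` {..<n}" by blast
  have "x m \<noteq> x n" if "m < n" for m n using x[of n] that by (metis DiffD2 imageI lessThan_iff)
  then have "inj x" by (metis injI linorder_neqE_nat)
  then show ?thesis using that x by blast
qed

theorem S_fin_ad_positive:
  assumes ad: "almost_disjoint_family D \<A>"
  shows "S_fin (ad_positive D \<A>) (ad_positive D \<A>)"
  unfolding S_fin_def
proof (intro allI impI)
  fix A :: "nat \<Rightarrow> 'a set"
  assume A: "\<forall>n. A n \<in> ad_positive D \<A>"
  then have AD: "A n \<subseteq> D" for n by (auto simp: ad_positive_def)
  define \<X> where "\<X> = {X \<in> \<A>. \<exists>x. (\<forall>n. x n \<in> A n) \<and> infinite (X \<inter> range x)}"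
  show "\<exists>F. (\<forall>n. finite (F n) \<and> F n \<subseteq> A n) \<and> (\<Union>n. F n) \<in> ad_positive D \<A>"
  proof (cases "finite \<X>")
    case True
    have "infinite (A n - \<Union>\<X>)" for n
      using A True unfolding \<X>_def ad_positive_def ad_ideal_def by blast
    then obtain x where x: "inj x" "\<And>n. x n \<in> A n - \<Union>\<X>"
      using injective_choice_sequence[of "\<lambda>n. A n - \<Union>\<X>"] by blast
    have "range x \<in> ad_positive D \<A>"
    proof (rule ccontr)
      assume "range x \<notin> ad_positive D \<A>"
      then have "range x \<in> ad_ideal D \<A>"
        using x(2) AD by (auto simp: ad_positive_def)
      then obtain X where "X \<in> \<A>" and X: "infinite (X \<inter> range x)"
        using infinite_ad_ideal_meets_member range_inj_infinite[OF x(1)] by metis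
      then have "X \<in> \<X>" using x(2) by (auto simp: \<X>_def)
      then have "X \<inter> range x = {}" using x(2) by blast
      then show False using X by simp
    qed
    then show ?thesis using x(2) by (intro exI[of _ "\<lambda>n. {x n}"]) (auto simp: UNION_singleton_eq_range)
  next
    case False
    then obtain X :: "nat \<Rightarrow> 'a set" where X: "inj X" "range X \<subseteq> \<X>"
      using infinite_countable_subset by blast
    then have "\<forall>k. \<exists>x. (\<forall>n. x n \<in> A n) \<and> infinite (X k \<inter> range x)"
      by (auto simp: \<X>_def)
    then obtain x where x: "\<And>k n. x k n \<in> A n" "\<And>k. infinite (X k \<inter> range (x k))"
      by metis
    define F where "F n = (\<lambda>k. x k n) ` {..n}" for n
    have "infinite (X k \<inter> (\<Union>n. F n))" for k
    proof
      \<comment> \<open>The sets \<open>F n\<close> omit at most the first \<open>k\<close> terms of \<open>x k\<close>.\<close>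
      assume "finite (X k \<inter> (\<Union>n. F n))"
      then have "finite ((X k \<inter> (\<Union>n. F n)) \<union> x k ` {..<k})" by simp
      moreover have "X k \<inter> range (x k) \<subseteq> (X k \<inter> (\<Union>n. F n)) \<union> x k ` {..<k}"
      proof
        fix y assume y: "y \<in> X k \<inter> range (x k)"
        then obtain n where n: "y = x k n" by blast
        show "y \<in> (X k \<inter> (\<Union>n. F n)) \<union> x k ` {..<k}"
        proof (cases "n < k")
          case False
          then have "y \<in> F n" using n by (auto simp: F_def)
          then show ?thesis using y by blast
        qed (use n in auto)
      qed
      ultimately have "finite (X k \<inter> range (x k))" by (rule finite_subset[rotated])
      then show False using x(2) by blast
    qed
    then have "range X \<subseteq> {Y \<in> \<A>. infinite (Y \<inter> (\<Union>n. F n))}"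
      using X(2) by (auto simp: \<X>_def)
    then have "infinite {Y \<in> \<A>. infinite (Y \<inter> (\<Union>n. F n))}"
      using range_inj_infinite[OF X(1)] by (rule infinite_super)
    then have "(\<Union>n. F n) \<notin> ad_ideal D \<A>"
      using ad_ideal_meets_finitely_many[OF ad] by blast
    moreover have FA: "F n \<subseteq> A n" for n using x(1) by (auto simp: F_def)
    ultimately have "(\<Union>n. F n) \<in> ad_positive D \<A>"
      using AD by (fastforce simp: ad_positive_def)
    then show ?thesis using FA by (intro exI[of _ F]) (auto simp: F_def)
  qed
qed

section \<open>Regions below the branches of a tree\<close>

text \<open>The code of the \<open>i\<close>-th immediate successor of the node \<open>s\<close> of the tree of finite sequences.\<close>

definition child :: "nat list \<Rightarrow> nat \<Rightarrow> nat" where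
  "child s i = to_nat (s @ [i])"

lemma child_eq_iff [simp]: "child s i = child t j \<longleftrightarrow> s = t \<and> i = j"
  by (simp add: child_def)

text \<open>
  The region of a branch \<open>f\<close> consists of all nodes \<open>f\<restriction>k \<frown> i\<close> with \<open>i \<le> f k\<close>. With \<open>\<le>\<close> instead
  of \<open><\<close> it is infinite for every \<open>f\<close>, even if \<open>f\<close> is eventually zero.
\<close>

definition branch_region :: "(nat \<Rightarrow> nat) \<Rightarrow> nat set" where
  "branch_region f = (\<Union>k. child (map f [0..<k]) ` {..f k})"

lemma child_in_branch_region_iff:
  "child s i \<in> branch_region f \<longleftrightarrow> s = map f [0..<length s] \<and> i \<le> f (length s)"
  by (fastforce simp: branch_region_def)

lemma infinite_branch_region: "infinite (branch_region f)"
proof -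
  have "inj (\<lambda>k. child (map f [0..<k]) 0)"
    by (rule injI) (auto dest: arg_cong[where f = length])
  moreover have "range (\<lambda>k. child (map f [0..<k]) 0) \<subseteq> branch_region f"
    by (auto simp: branch_region_def)
  ultimately show ?thesis using infinite_super range_inj_infinite by metis
qed

lemma finite_branch_region_Int:
  assumes "f \<noteq> g"
  shows "finite (branch_region f \<inter> branch_region g)"
proof -
  obtain m where m: "f m \<noteq> g m" using assms by blast
  have "branch_region f \<inter> branch_region g \<subseteq> (\<Union>k\<le>m. child (map f [0..<k]) ` {..f k})"
  proof
    fix x assume x: "x \<in> branch_region f \<inter> branch_region g"
    then obtain k i where k: "x = child (map f [0..<k]) i" "i \<le> f k"
      by (auto simp: branch_region_def)
    with x have "map f [0..<k] = map g [0..<k]"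
      by (simp add: child_in_branch_region_iff)
    then have "\<not> m < k" using m by auto
    then show "x \<in> (\<Union>k\<le>m. child (map f [0..<k]) ` {..f k})" using k by auto
  qed
  then show ?thesis by (rule finite_subset) simp
qed

lemma inj_branch_region: "inj branch_region"
  by (rule injI) (metis finite_branch_region_Int infinite_branch_region Int_absorb)

lemma almost_disjoint_branch_regions:
  "almost_disjoint_family UNIV (range branch_region)"
proof -
  have "finite (branch_region f \<inter> branch_region g)" if "branch_region f \<noteq> branch_region g" for f g
    using that by (intro finite_branch_region_Int) auto
  then show ?thesis
    unfolding almost_disjoint_family_def pairwise_image
    by (auto simp: pairwise_def infinite_branch_region simp del: finite_Int)
qed

lemma branch_regions_eqpoll_continuum: "range branch_region \<approx> (UNIV :: nat set set)"
proof (rule lepoll_antisym)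
  show "range branch_region \<lesssim> (UNIV :: nat set set)" by (simp add: subset_imp_lepoll)
  have "inj (\<lambda>S :: nat set. branch_region (\<lambda>n. of_bool (n \<in> S)))"
  proof (rule injI)
    fix S T :: "nat set"
    assume "branch_region (\<lambda>n. of_bool (n \<in> S)) = branch_region (\<lambda>n. of_bool (n \<in> T))"
    then have "(\<lambda>n. of_bool (n \<in> S) :: nat) = (\<lambda>n. of_bool (n \<in> T))"
      by (rule injD[OF inj_branch_region])
    then have "of_bool (n \<in> S) = (of_bool (n \<in> T) :: nat)" for n by (rule fun_cong)
    then show "S = T" by (auto simp: of_bool_eq_iff)
  qed
  then show "(UNIV :: nat set set) \<lesssim> range branch_region"
    unfolding lepoll_def by blast
qed

lemma children_positive: "range (child s) \<in> ad_positive UNIV (range branch_region)"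
proof -
  have "finite (X \<inter> range (child s))" if "X \<in> range branch_region" for X
  proof -
    from that obtain f where "X = branch_region f" by blast
    then have "X \<inter> range (child s) \<subseteq> child s ` {..f (length s)}"
      by (auto simp: child_in_branch_region_iff)
    then show ?thesis by (rule finite_subset) simp
  qed
  moreover have "infinite (range (child s))" by (rule range_inj_infinite) (simp add: inj_def)
  ultimately have "range (child s) \<notin> ad_ideal UNIV (range branch_region)"
    by (meson infinite_ad_ideal_meets_member)
  then show ?thesis by (simp add: ad_positive_def)
qed

text \<open>An upper bound for the last entries of the nodes coded in a finite set.\<close>

definition last_entry_bound :: "nat set \<Rightarrow> nat" where
  "last_entry_bound F = Max (insert 0 ((\<lambda>x. last (from_nat x :: nat list)) ` F))"

lemma le_last_entry_bound:
  assumes "finite F" "child s i \<in> F"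
  shows "i \<le> last_entry_bound F"
proof -
  have "last (from_nat (child s i) :: nat list) = i" by (simp add: child_def)
  then have "i \<in> insert 0 ((\<lambda>x. last (from_nat x :: nat list)) ` F)"
    using assms(2) by (metis imageI insertI2)
  then show ?thesis unfolding last_entry_bound_def using assms(1) by (intro Max_ge) auto
qed

theorem I_wins_branch_regions:
  "I_wins_G_fin (ad_positive UNIV (range branch_region)) (ad_positive UNIV (range branch_region))"
proof -
  define \<sigma> where "\<sigma> Fs = range (child (map last_entry_bound Fs))" for Fs
  have "(\<Union>n. F n) \<in> ad_ideal UNIV (range branch_region)"
    if F: "\<forall>n. finite (F n) \<and> F n \<subseteq> I_move \<sigma> F n" for F
  proof -
    define f where "f n = last_entry_bound (F n)" for n
    have move: "I_move \<sigma> F n = range (child (map f [0..<n]))" for n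
      by (simp add: I_move_def \<sigma>_def f_def[abs_def] comp_def)
    have "x \<in> branch_region f" if x: "x \<in> F n" for x n
    proof -
      obtain i where i: "x = child (map f [0..<n]) i" using F x move by blast
      moreover have "i \<le> f n" using F x i unfolding f_def by (metis le_last_entry_bound)
      ultimately show ?thesis by (auto simp: branch_region_def)
    qed
    then have "(\<Union>n. F n) \<subseteq> branch_region f" by blast
    moreover have "branch_region f \<in> ad_ideal UNIV (range branch_region)"
      by (rule ad_ideal_member) auto
    ultimately show ?thesis by (rule ad_ideal_mono[rotated])
  qed
  then have "G_fin_winning_strategy_I (ad_positive UNIV (range branch_region))
      (ad_positive UNIV (range branch_region)) \<sigma>"
    unfolding G_fin_winning_strategy_I_def
    using children_positive by (auto simp: I_move_def \<sigma>_def ad_positive_def)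
  then show ?thesis unfolding I_wins_G_fin_def by blast
qed

section \<open>The lattice of an ideal of sets\<close>

text \<open>
  A proper ideal \<open>I\<close> of subsets of \<open>D\<close> that contains the finite sets. Ordered by inclusion,
  \<open>I \<union> {D}\<close> is a lattice in which infima are intersections but suprema of infinite families
  need not be unions.
\<close>

locale ideal_lattice =
  fixes D :: "'a set" and I :: "'a set set"
  assumes ideal_subset: "S \<in> I \<Longrightarrow> S \<subseteq> D"
    and ideal_mono: "T \<in> I \<Longrightarrow> S \<subseteq> T \<Longrightarrow> S \<in> I"
    and ideal_Un: "S \<in> I \<Longrightarrow> T \<in> I \<Longrightarrow> S \<union> T \<in> I"
    and ideal_finite: "finite S \<Longrightarrow> S \<subseteq> D \<Longrightarrow> S \<in> I"
    and ideal_proper: "D \<notin> I"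
begin

definition lat :: "'a set gorder" where
  "lat = \<lparr>carrier = insert D I, eq = (=), le = (\<subseteq>)\<rparr>"

lemma carrier_lat [simp]: "carrier lat = insert D I"
  and eq_lat [simp]: "eq lat = (=)"
  and le_lat [simp]: "le lat = (\<subseteq>)"
  by (simp_all add: lat_def)

lemma carrier_subset: "S \<in> insert D I \<Longrightarrow> S \<subseteq> D"
  using ideal_subset by auto

lemma Union_carrier_subset: "B \<subseteq> insert D I \<Longrightarrow> \<Union>B \<subseteq> D"
  by (meson Union_least carrier_subset subsetD)

lemma partial_order_lat: "partial_order lat"
  by unfold_locales auto

lemma is_lub_lat:
  assumes "B \<subseteq> insert D I"
  shows "is_lub lat (if \<Union>B \<in> I then \<Union>B else D) B"
proof -
  have BD: "\<Union>B \<subseteq> D" using assms by (rule Union_carrier_subset)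
  show ?thesis
  proof (cases "\<Union>B \<in> I")
    case True
    then show ?thesis using assms by (auto simp: least_def Upper_def)
  next
    case False
    have "U = D" if "U \<in> Upper lat B" for U
    proof -
      have "\<Union>B \<subseteq> U" "U \<in> insert D I" using that assms by (auto simp: Upper_def)
      then show ?thesis using False ideal_mono[of U "\<Union>B"] by auto
    qed
    moreover have "D \<in> Upper lat B" using BD by (auto simp: Upper_def)
    ultimately have "Upper lat B = {D}" by blast
    then show ?thesis using False by (simp add: least_def)
  qed
qed

lemma is_glb_lat:
  assumes "B \<subseteq> insert D I"
  shows "is_glb lat (D \<inter> \<Inter>B) B"
proof -
  have "D \<inter> \<Inter>B \<in> insert D I"
  proof (cases "B \<subseteq> {D}")
    case False
    then obtain S where "S \<in> B" "S \<in> I" using assms by blast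
    then show ?thesis using ideal_mono[of S "D \<inter> \<Inter>B"] by blast
  qed auto
  then show ?thesis
    using assms by (auto simp: greatest_def Lower_def dest: ideal_subset)
qed

lemma complete_lattice_lat: "complete_lattice lat"
proof (rule partial_order.complete_latticeI[OF partial_order_lat])
  fix B assume "B \<subseteq> carrier lat"
  then have "B \<subseteq> insert D I" by simp
  then show "\<exists>U. is_lub lat U B" "\<exists>U. is_glb lat U B"
    using is_lub_lat is_glb_lat by (blast, blast)
qed

lemma bounded_lattice_lat: "bounded_lattice lat"
proof -
  interpret complete_lattice lat by (rule complete_lattice_lat)
  show ?thesis by unfold_locales
qed

lemma top_lat: "\<top>\<^bsub>lat\<^esub> = D"
  unfolding top_def
  by (rule some_equality) (auto simp: greatest_def dest: ideal_subset)

lemma join_lat: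
  assumes "S \<in> carrier lat" "T \<in> carrier lat"
  shows "S \<squnion>\<^bsub>lat\<^esub> T = S \<union> T"
proof -
  have lub: "is_lub lat (S \<union> T) {S, T}"
    using assms carrier_subset[of S] carrier_subset[of T] ideal_Un
    by (auto simp: least_def Upper_def)
  show ?thesis
    unfolding join_def sup_def
    using lub by (rule some_equality) (rule partial_order.least_unique[OF partial_order_lat _ lub])
qed

lemma meet_lat:
  assumes "S \<in> carrier lat" "T \<in> carrier lat"
  shows "S \<sqinter>\<^bsub>lat\<^esub> T = S \<inter> T"
proof -
  have glb: "is_glb lat (S \<inter> T) {S, T}"
    using is_glb_lat[of "{S, T}"] assms carrier_subset[of S] carrier_subset[of T]
    by (simp add: inf.absorb2 le_infI1)
  show ?thesis
    unfolding meet_def inf_def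
    using glb by (rule some_equality) (rule partial_order.greatest_unique[OF partial_order_lat _ glb])
qed

lemma distributive_lattice_lat: "distributive_lattice lat"
proof -
  interpret complete_lattice lat by (rule complete_lattice_lat)
  show ?thesis
  proof
    fix R S T assume RST: "R \<in> carrier lat" "S \<in> carrier lat" "T \<in> carrier lat"
    then have "S \<union> T \<in> carrier lat" "R \<inter> S \<in> carrier lat" "R \<inter> T \<in> carrier lat"
      using join_closed[of S T] meet_closed[of R S] meet_closed[of R T]
      by (simp_all only: join_lat meet_lat)
    then show "R \<sqinter>\<^bsub>lat\<^esub> (S \<squnion>\<^bsub>lat\<^esub> T) = (R \<sqinter>\<^bsub>lat\<^esub> S) \<squnion>\<^bsub>lat\<^esub> (R \<sqinter>\<^bsub>lat\<^esub> T)"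
      using RST by (simp only: join_lat meet_lat Int_Un_distrib)
  qed
qed

lemma sup_top_families_iff:
  "B \<in> sup_top_families lat \<longleftrightarrow> B \<subseteq> insert D I \<and> \<Union>B \<in> Pow D - I"
proof -
  have "B \<noteq> {} \<and> is_lub lat D B \<longleftrightarrow> \<Union>B \<in> Pow D - I" if B: "B \<subseteq> insert D I"
  proof
    assume *: "B \<noteq> {} \<and> is_lub lat D B"
    then have "(if \<Union>B \<in> I then \<Union>B else D) = D"
      using partial_order.least_unique[OF partial_order_lat] is_lub_lat[OF B] by blast
    then have "\<Union>B \<notin> I" using ideal_proper by (auto split: if_splits)
    then show "\<Union>B \<in> Pow D - I" using Union_carrier_subset[OF B] by simp
  next
    assume *: "\<Union>B \<in> Pow D - I"
    then have "B \<noteq> {}" using ideal_finite[of "{}"] by auto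
    then show "B \<noteq> {} \<and> is_lub lat D B" using is_lub_lat[OF B] * by simp
  qed
  then show ?thesis by (auto simp: sup_top_families_def top_lat)
qed

text \<open>
  Finitely many points of \<open>\<Union>(A n)\<close> are covered by finitely many members of \<open>A n\<close>, so it is enough
  to select points.
\<close>

theorem S_fin_lat:
  assumes "S_fin (Pow D - I) (Pow D - I)"
  shows "S_fin (sup_top_families lat) (sup_top_families lat)"
  unfolding S_fin_def
proof (intro allI impI)
  fix A :: "nat \<Rightarrow> 'a set set"
  assume "\<forall>n. A n \<in> sup_top_families lat"
  then have A: "A n \<subseteq> insert D I" "\<Union>(A n) \<in> Pow D - I" for n
    by (simp_all add: sup_top_families_iff)
  have "\<forall>n. \<Union>(A n) \<in> Pow D - I" using A(2) by simp
  with assms[unfolded S_fin_def, THEN spec, of "\<lambda>n. \<Union>(A n)"]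
  have "\<exists>G. (\<forall>n. finite (G n) \<and> G n \<subseteq> \<Union>(A n)) \<and> (\<Union>n. G n) \<in> Pow D - I"
    by (rule mp)
  then obtain G where G: "\<forall>n. finite (G n) \<and> G n \<subseteq> \<Union>(A n)" "(\<Union>n. G n) \<in> Pow D - I"
    by (elim exE conjE)
  have "\<exists>F. finite F \<and> F \<subseteq> A n \<and> G n \<subseteq> \<Union>F" for n
    using G(1) finite_subset_Union[of "G n" "A n"] by metis
  then obtain F where F: "\<And>n. finite (F n)" "\<And>n. F n \<subseteq> A n" "\<And>n. G n \<subseteq> \<Union>(F n)"
    by metis
  have FD: "(\<Union>n. F n) \<subseteq> insert D I" using F(2) A(1) by blast
  have "(\<Union>n. G n) \<subseteq> \<Union>(\<Union>n. F n)" using F(3) by blast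
  then have "\<Union>(\<Union>n. F n) \<notin> I" using G(2) ideal_mono[of "\<Union>(\<Union>n. F n)" "\<Union>n. G n"] by blast
  moreover have "\<Union>(\<Union>n. F n) \<subseteq> D" using FD by (rule Union_carrier_subset)
  ultimately have "(\<Union>n. F n) \<in> sup_top_families lat"
    using FD by (simp add: sup_top_families_iff)
  then show "\<exists>F. (\<forall>n. finite (F n) \<and> F n \<subseteq> A n) \<and> (\<Union>n. F n) \<in> sup_top_families lat"
    using F(1,2) by blast
qed

theorem I_wins_lat:
  assumes "I_wins_G_fin (Pow D - I) (Pow D - I)"
  shows "I_wins_G_fin (sup_top_families lat) (sup_top_families lat)"
proof -
  obtain \<sigma> where \<sigma>: "G_fin_winning_strategy_I (Pow D - I) (Pow D - I) \<sigma>"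
    using assms unfolding I_wins_G_fin_def by blast
  define \<tau> where "\<tau> Fs = (\<lambda>x. {x}) ` \<sigma> (map Union Fs)" for Fs
  have "(\<forall>n. I_move \<tau> F n \<in> sup_top_families lat) \<and> (\<Union>n. F n) \<notin> sup_top_families lat"
    if F: "\<forall>n. finite (F n) \<and> F n \<subseteq> I_move \<tau> F n" for F
  proof -
    define G where "G n = \<Union>(F n)" for n
    have move: "I_move \<tau> F n = (\<lambda>x. {x}) ` I_move \<sigma> G n" for n
      by (simp add: I_move_def \<tau>_def G_def[abs_def] comp_def)
    have "finite (G n) \<and> G n \<subseteq> I_move \<sigma> G n" for n
    proof -
      have Fn: "finite (F n)" "F n \<subseteq> (\<lambda>x. {x}) ` I_move \<sigma> G n" using F move by auto
      then have "finite (\<Union>(F n))" by (intro finite_Union) auto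
      moreover have "\<Union>(F n) \<subseteq> I_move \<sigma> G n" using Fn(2) by blast
      ultimately show ?thesis by (simp add: G_def)
    qed
    then have pos: "I_move \<sigma> G n \<in> Pow D - I" and neg: "(\<Union>n. G n) \<notin> Pow D - I" for n
      using \<sigma> unfolding G_fin_winning_strategy_I_def by blast+
    have "I_move \<tau> F n \<in> sup_top_families lat" for n
    proof -
      have "\<Union>(I_move \<tau> F n) = I_move \<sigma> G n" by (auto simp: move)
      moreover have "I_move \<tau> F n \<subseteq> I" using pos[of n] ideal_finite by (auto simp: move)
      ultimately show ?thesis using pos[of n] by (auto simp: sup_top_families_iff)
    qed
    moreover have "\<Union>(\<Union>n. F n) = (\<Union>n. G n)" by (auto simp: G_def)
    ultimately show ?thesis using neg by (simp add: sup_top_families_iff)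
  qed
  then have "G_fin_winning_strategy_I (sup_top_families lat) (sup_top_families lat) \<tau>"
    unfolding G_fin_winning_strategy_I_def by blast
  then show ?thesis unfolding I_wins_G_fin_def by blast
qed

end

section \<open>The family of branch regions and its lattice\<close>

theorem proposition6p4:
  shows "(\<exists>(D :: nat set) (\<A> :: nat set set).
            countable D \<and> infinite D \<and>
            almost_disjoint_family D \<A> \<and> \<A> \<approx> (UNIV :: nat set set) \<and>
            S_fin (ad_positive D \<A>) (ad_positive D \<A>) \<and>
            I_wins_G_fin (ad_positive D \<A>) (ad_positive D \<A>)) \<and>
         (\<exists>L :: nat set gorder.
            complete_lattice L \<and> bounded_lattice L \<and> distributive_lattice L \<and>
            carrier L \<approx> (UNIV :: nat set set) \<and>
            S_fin (sup_top_families L) (sup_top_families L) \<and>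
            I_wins_G_fin (sup_top_families L) (sup_top_families L))"
proof -
  let ?\<A> = "range branch_region"
  have pos: "ad_positive UNIV ?\<A> = Pow UNIV - ad_ideal UNIV ?\<A>"
    by (simp add: ad_positive_def)
  have sel: "S_fin (ad_positive UNIV ?\<A>) (ad_positive UNIV ?\<A>)"
    by (rule S_fin_ad_positive[OF almost_disjoint_branch_regions])
  have "UNIV \<notin> ad_ideal UNIV ?\<A>"
    using children_positive[of "[]"] ad_ideal_mono[OF _ subset_UNIV] unfolding pos by blast
  then interpret ideal_lattice UNIV "ad_ideal UNIV ?\<A>"
    by unfold_locales (auto intro: ad_ideal_mono ad_ideal_Un ad_ideal_finite)
  have "?\<A> \<subseteq> carrier lat"
    by (auto intro: ad_ideal_member)
  then have "?\<A> \<lesssim> carrier lat" by (rule subset_imp_lepoll)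
  then have "(UNIV :: nat set set) \<lesssim> carrier lat"
    using branch_regions_eqpoll_continuum eqpoll_sym lepoll_trans1 by blast
  then have "carrier lat \<approx> (UNIV :: nat set set)"
    by (intro lepoll_antisym) (simp_all add: subset_imp_lepoll)
  then have "\<exists>L :: nat set gorder.
      complete_lattice L \<and> bounded_lattice L \<and> distributive_lattice L \<and>
      carrier L \<approx> (UNIV :: nat set set) \<and>
      S_fin (sup_top_families L) (sup_top_families L) \<and>
      I_wins_G_fin (sup_top_families L) (sup_top_families L)"
    using complete_lattice_lat bounded_lattice_lat distributive_lattice_lat
      S_fin_lat[OF sel[unfolded pos]] I_wins_lat[OF I_wins_branch_regions[unfolded pos]]
    by blast
  moreover have "countable (UNIV :: nat set)" "infinite (UNIV :: nat set)" by auto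
  ultimately show ?thesis
    using almost_disjoint_branch_regions branch_regions_eqpoll_continuum sel I_wins_branch_regions
    by blast
qed

end
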